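(* Let $\mathcal{A}\in T_{m,n}$ and $q\in\mathbb{R}^n$, and let $H$ be the homotopy function defined in the context. For almost all initial points $v^{(0)}\in\mathcal{F}_1$, $0$ is a regular value of the homotopy function $H_{v^{(0)}}=H(\cdot,v^{(0)},\cdot):\mathbb{R}^{4n}\times(0,1]\to\mathbb{R}^{4n}$, and the zero point set $H_{v^{(0)}}^{-1}(0)=\{(v,\mu)\in\mathcal{F}_1\times(0,1]: H(v,v^{(0)},\mu)=0\}$ contains a smooth curve $\Gamma_{v^{(0)}}$ starting from $(v^{(0)},1)$.
   Context: $T_{m,n}$ is the set of real tensors $\mathcal{A}=(a_{i_1i_2\cdots i_m})$ of order $m$ and dimension $n$, with $i_j\in\{1,\dots,n\}$ (with $m\ge 2$, so that the expressions below make sense). For $x\in\mathbb{R}^n$, $\mathcal{A}x^{m-2}\in\mathbb{R}^{n\times n}$ is the matrix with entries $(\mathcal{A}x^{m-2})_{ij}=\sum_{i_3,\dots,i_m=1}^n a_{iji_3\cdots i_m}x_{i_3}\cdots x_{i_m}$, and $\mathcal{A}x^{m-1}\in\mathbb{R}^n$ is the vector with entries $(\mathcal{A}x^{m-1})_i=\sum_{i_2,\dots,i_m=1}^n a_{ii_2\cdots i_m}x_{i_2}\cdots x_{i_m}$. The partially symmetrized tensor $\hat{\mathcal{A}}$ of $\mathcal{A}$ has entries $\hat a_{i_1i_2\cdots i_m}=\frac{1}{(m-1)!}\sum_\pi a_{i_1\pi(i_2\cdots i_m)}$, the sum being over all permutations $\pi(i_2\cdots i_m)$ of the indices $i_2,\dots,i_m$.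 $\mathcal{F}_1=\{(x,w,z_1,z_2)\in(\mathbb{R}^n)^4: x>0,\,w>0,\,z_1>0,\,z_2>0\}$ (componentwise inequalities). Write $v=(x,w,z_1,z_2)$ and $v^{(0)}=(x^{(0)},w^{(0)},z_1^{(0)},z_2^{(0)})\in\mathcal{F}_1$, and $X=\mathrm{diag}(x)$, $Z_j=\mathrm{diag}(z_j)$, $Z_j^{(0)}=\mathrm{diag}(z_j^{(0)})$ for $j=1,2$. The homotopy function is $$H(v,v^{(0)},\mu)=\begin{bmatrix}(1-\mu)\big(w-z_1+(m-1)(\hat{\mathcal{A}}x^{m-2})^T(x-z_2)\big)+\mu(x-x^{(0)})\\ Z_1x-\mu Z_1^{(0)}x^{(0)}\\ Z_2w-\mu Z_2^{(0)}w^{(0)}+(1-\mu)Xw\\ w-(1-\mu)(\mathcal{A}x^{m-1}+q)-\mu w^{(0)}\end{bmatrix},\qquad \mu\in(0,1].$$ A point $y\in\mathbb{R}^p$ is a regular value of a smooth map $f$ if the derivative $Df(u)$ is onto $\mathbb{R}^p$ for every $u\in f^{-1}(y)$. For fixed $v^{(0)}$, the derivative is taken with respect to $(v,\mu)$. *)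

theory Defs
  imports "HOL-Analysis.Analysis" "HOL-Combinatorics.Permutations"
begin

text \<open>
  A real tensor of order \<open>m\<close> and dimension \<open>CARD('n)\<close> is a function on index lists; only its values
  on lists of length \<open>m\<close> (the tuples \<open>i\<^sub>1, \<dots>, i\<^sub>m\<close>) enter the definitions below, so the order is
  passed separately as a parameter \<open>m \<ge> 2\<close>.
\<close>

type_synonym 'n tensor = "'n list \<Rightarrow> real"

type_synonym 'n quad = "(real^'n) \<times> (real^'n) \<times> (real^'n) \<times> (real^'n)"

definition monomial_at :: "real^'n \<Rightarrow> 'n list \<Rightarrow> real" where
  "monomial_at x is = prod_list (map (\<lambda>i. x $ i) is)"

definition tensor_matrix :: "nat \<Rightarrow> 'n tensor \<Rightarrow> real^'n \<Rightarrow> real^'n^'n::finite" where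
  "tensor_matrix m A x = (\<chi> i j. \<Sum>is | length is = m - 2. A (i # j # is) * monomial_at x is)"

definition tensor_vector :: "nat \<Rightarrow> 'n tensor \<Rightarrow> real^'n \<Rightarrow> real^'n::finite" where
  "tensor_vector m A x = (\<chi> i. \<Sum>is | length is = m - 1. A (i # is) * monomial_at x is)"

text \<open>
  On an index list of length \<open>m\<close> the tail has length \<open>m - 1\<close>, so the sum below has \<open>(m - 1)!\<close> terms
  (repeated indices are counted with multiplicity) and the denominator is \<open>(m - 1)!\<close>.
\<close>

fun partial_symmetrization :: "'n tensor \<Rightarrow> 'n tensor" where
  "partial_symmetrization A [] = A []"
| "partial_symmetrization A (i # is) =
     1 / fact (length is) * (\<Sum>\<pi> | \<pi> permutes {..<length is}. A (i # permute_list \<pi> is))"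

definition diag :: "real^'n \<Rightarrow> real^'n^'n::finite" where
  "diag x = (\<chi> i j. if i = j then x $ i else 0)"

definition F1 :: "('n::finite) quad set" where
  "F1 = {(x, w, z1, z2). \<forall>i. x $ i > 0 \<and> w $ i > 0 \<and> z1 $ i > 0 \<and> z2 $ i > 0}"

fun homotopy ::
  "nat \<Rightarrow> 'n tensor \<Rightarrow> real^'n \<Rightarrow> 'n quad \<Rightarrow> 'n quad \<Rightarrow> real \<Rightarrow> ('n::finite) quad" where
  "homotopy m A q (x, w, z1, z2) (x0, w0, z10, z20) \<mu> =
    ( (1 - \<mu>) *\<^sub>R (w - z1 + (real m - 1) *\<^sub>R
         (transpose (tensor_matrix m (partial_symmetrization A) x) *v (x - z2))) + \<mu> *\<^sub>R (x - x0)
    , diag z1 *v x - \<mu> *\<^sub>R (diag z10 *v x0)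
    , diag z2 *v w - \<mu> *\<^sub>R (diag z20 *v w0) + (1 - \<mu>) *\<^sub>R (diag x *v w)
    , w - (1 - \<mu>) *\<^sub>R (tensor_vector m A x + q) - \<mu> *\<^sub>R w0 )"

definition homotopy_zeros ::
  "nat \<Rightarrow> 'n tensor \<Rightarrow> real^'n \<Rightarrow> 'n quad \<Rightarrow> (('n::finite) quad \<times> real) set" where
  "homotopy_zeros m A q v0 = {(v, \<mu>). v \<in> F1 \<and> \<mu> \<in> {0<..1} \<and> homotopy m A q v v0 \<mu> = 0}"

text \<open>
  The domain \<open>U\<close> need not be open: for \<open>U = UNIV \<times> {0<..1}\<close> the derivative at \<open>\<mu> = 1\<close> is one-sided
  in \<open>\<mu>\<close>.  The derivative within such a set is unique, as the set is convex with nonempty interior.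
\<close>

definition regular_value ::
  "('a::real_normed_vector \<Rightarrow> 'b::real_normed_vector) \<Rightarrow> 'a set \<Rightarrow> 'b \<Rightarrow> bool" where
  "regular_value f U y \<longleftrightarrow>
     (\<forall>u\<in>U. f u = y \<longrightarrow> (\<exists>f'. (f has_derivative f') (at u within U) \<and> surj f'))"

text \<open>
  \<open>D k\<close> is the \<open>k\<close>-th derivative of the parametrization \<open>D 0\<close> (one-sided at the starting point), so the
  parametrization is infinitely differentiable.  Immersion and homeomorphism onto the image
  exclude constant, cuspidal and self-accumulating paths.
\<close>

definition smooth_curve_from :: "'a::real_normed_vector \<Rightarrow> 'a set \<Rightarrow> bool" where
  "smooth_curve_from p \<Gamma> \<longleftrightarrow>
     (\<exists>D :: nat \<Rightarrow> real \<Rightarrow> 'a.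
        (\<forall>k. \<forall>t\<in>{0..<1}. (D k has_vector_derivative D (Suc k) t) (at t within {0..<1})) \<and>
        (\<forall>t\<in>{0..<1}. D 1 t \<noteq> 0) \<and>
        (\<exists>g. homeomorphism {0..<1} \<Gamma> (D 0) g) \<and>
        D 0 0 = p)"

end

theory Submission
  imports Defs
begin

text \<open>
Write \<open>E(v, \<mu>)\<close> for the homotopy with starting point \<open>0\<close> and put
\<open>P(v0) = (x0, Z1 x0, Z2 w0, w0)\<close> for \<open>v0 = (x0, w0, z1, z2)\<close>.  Then
\<open>H(v, v0, \<mu>) = E(v, \<mu>) - \<mu> P(v0)\<close>, and \<open>P\<close> is injective on \<open>F1\<close> with a differentiable
inverse.  Hence \<open>0\<close> is a regular value of \<open>H(\<cdot>, v0, \<cdot>)\<close> as soon as \<open>P(v0)\<close> is a regular value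
of \<open>\<Psi> = E / \<mu>\<close>, and it suffices to show that the relevant critical values of \<open>\<Psi>\<close> form a null
set.  Since \<open>\<Psi>\<close> maps a space of dimension \<open>4n + 1\<close> to one of dimension \<open>4n\<close>, this is an instance
of the Sard theorem in which the dimension drops by one.

As \<open>E\<close> is a polynomial map, this instance reduces to the easy Sard theorem for maps between
spaces of equal dimension (\<open>negligible_critical_parameters\<close>).  At a critical point the
determinant \<open>J\<close> of the partial derivative \<open>D\<^sub>vE\<close> vanishes.  For fixed \<open>v\<close>, however, \<open>J(v, \<mu>)\<close> is a
polynomial in \<open>\<mu>\<close>, and its value at \<open>\<mu> = 1\<close> is nonzero when no component of \<open>x\<close> and \<open>w\<close> vanishes,
which the second and third block of the homotopy force at every zero with \<open>\<mu> > 0\<close>.  So at every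
critical point there is a \<open>k\<close> such that the \<open>k\<close>-th derivative of \<open>J\<close> with respect to \<open>\<mu>\<close> vanishes
while the next one does not.  For each of these countably many \<open>k\<close>, the implicit function
theorem covers the set of such points by countably many graphs \<open>\<mu> = \<phi>(v)\<close>, and on each graph
\<open>v \<mapsto> \<Psi>(v, \<phi>(v))\<close> is a map between spaces of equal dimension that is critical at the points in
question.

The curve is obtained in \<open>smooth_solution_curve\<close>.  At \<open>(v0, 1)\<close> the determinant \<open>J\<close> is nonzero, so
the inverse function theorem yields a curve \<open>u(t)\<close> of zeros with \<open>\<mu> = 1 - \<delta> t\<close>.  By Cramer's rule
\<open>u' = M(u) / J(u)\<close> with a polynomial map \<open>M\<close>; therefore every derivative of \<open>u\<close> is again a
polynomial map divided by a power of \<open>J\<close>, evaluated along \<open>u\<close>, and \<open>u\<close> is infinitely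
differentiable.  The last component \<open>-\<delta>\<close> of \<open>u'\<close> shows that the curve is immersed and injective.
\<close>

section \<open>Polynomial maps and their derivatives\<close>

lemma real_polynomial_function_has_derivative:
  "real_polynomial_function f \<Longrightarrow> (f has_derivative frechet_derivative f (at x)) (at x)"
  using differentiable_at_real_polynomial_function frechet_derivative_works by blast

lemma polynomial_function_has_derivative:
  fixes f :: "'a::euclidean_space \<Rightarrow> 'b::euclidean_space"
  shows "polynomial_function f \<Longrightarrow> (f has_derivative frechet_derivative f (at x)) (at x)"
  using differentiable_at_polynomial_function frechet_derivative_works by blast

text \<open>
By induction on the construction of \<open>f\<close>, the product rule settling the multiplicative step.
Iterating the lemma gives partial derivatives of every order without leaving the polynomials.
\<close>

lemma real_polynomial_function_frechet_derivative:
  "real_polynomial_function f \<Longrightarrow> real_polynomial_function (\<lambda>x. frechet_derivative f (at x) e)"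
proof (induction f rule: real_polynomial_function.induct)
  case (linear f)
  then have "frechet_derivative f (at x) = f" for x
    by (metis bounded_linear_imp_has_derivative frechet_derivative_at)
  then show ?case
    by (simp add: real_polynomial_function.intros)
next
  case (const c)
  then show ?case
    by (simp add: real_polynomial_function.intros)
next
  case (add f g)
  have "((\<lambda>x. f x + g x) has_derivative
      (\<lambda>h. frechet_derivative f (at x) h + frechet_derivative g (at x) h)) (at x)" for x
    using add.hyps by (intro has_derivative_add real_polynomial_function_has_derivative)
  then have "frechet_derivative (\<lambda>x. f x + g x) (at x) e
      = frechet_derivative f (at x) e + frechet_derivative g (at x) e" for x
    by (metis frechet_derivative_at)
  then show ?case
    using add.IH by (simp add: real_polynomial_function.intros)
next
  case (mult f g)
  have "((\<lambda>x. f x * g x) has_derivative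
      (\<lambda>h. f x * frechet_derivative g (at x) h + frechet_derivative f (at x) h * g x)) (at x)" for x
    using mult.hyps by (intro has_derivative_mult real_polynomial_function_has_derivative)
  then have "frechet_derivative (\<lambda>x. f x * g x) (at x) e
      = f x * frechet_derivative g (at x) e + frechet_derivative f (at x) e * g x" for x
    by (metis (no_types, lifting) frechet_derivative_at)
  then show ?case
    using mult by (simp add: real_polynomial_function.intros)
qed

lemma polynomial_function_frechet_derivative_fixed:
  fixes f :: "'a::euclidean_space \<Rightarrow> 'b::euclidean_space"
  assumes "polynomial_function f"
  shows "polynomial_function (\<lambda>x. frechet_derivative f (at x) e)"
  unfolding polynomial_function_iff_Basis_inner
proof
  fix b :: 'b assume "b \<in> Basis"
  have "((\<lambda>x. f x \<bullet> b) has_derivative (\<lambda>h. frechet_derivative f (at x) h \<bullet> b)) (at x)" for x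
    by (intro has_derivative_inner_left polynomial_function_has_derivative assms)
  then have "frechet_derivative (\<lambda>x. f x \<bullet> b) (at x) e = frechet_derivative f (at x) e \<bullet> b" for x
    by (metis frechet_derivative_at)
  moreover have "real_polynomial_function (\<lambda>x. f x \<bullet> b)"
    using assms polynomial_function_inner by (auto simp: real_polynomial_function_eq)
  ultimately show "real_polynomial_function (\<lambda>x. frechet_derivative f (at x) e \<bullet> b)"
    using real_polynomial_function_frechet_derivative[of "\<lambda>x. f x \<bullet> b" e] by simp
qed

text \<open>
Expanding the direction \<open>M x\<close> in the standard basis reduces a varying direction to fixed ones.
\<close>

lemma polynomial_function_frechet_derivative:
  fixes f :: "'a::euclidean_space \<Rightarrow> 'b::euclidean_space"
  assumes f: "polynomial_function f" and M: "polynomial_function M"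
  shows "polynomial_function (\<lambda>x. frechet_derivative f (at x) (M x))"
proof -
  have "frechet_derivative f (at x) (M x)
      = (\<Sum>b\<in>Basis. (M x \<bullet> b) *\<^sub>R frechet_derivative f (at x) b)" for x
  proof -
    interpret linear "frechet_derivative f (at x)"
      using polynomial_function_has_derivative[OF f] has_derivative_linear by blast
    have "frechet_derivative f (at x) (\<Sum>b\<in>Basis. (M x \<bullet> b) *\<^sub>R b)
      = (\<Sum>b\<in>Basis. (M x \<bullet> b) *\<^sub>R frechet_derivative f (at x) b)"
      by (simp add: sum scaleR)
    then show ?thesis by (simp add: euclidean_representation)
  qed
  then show ?thesis
    using f M by (auto intro!: polynomial_function_sum polynomial_function_mult
        polynomial_function_frechet_derivative_fixed polynomial_function_inner)
qed

lemma polynomial_function_Pair: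
  assumes "polynomial_function f" "polynomial_function g"
  shows "polynomial_function (\<lambda>x. (f x, g x))"
  unfolding polynomial_function_def
proof (intro allI impI)
  fix h :: "'b \<times> 'c \<Rightarrow> real" assume h: "bounded_linear h"
  then have "h (f x, g x) = h (f x, 0) + h (0, g x)" for x
    by (simp add: linear_add[symmetric] bounded_linear.linear)
  moreover have "bounded_linear (\<lambda>y. h (y, 0))" "bounded_linear (\<lambda>z. h (0, z))"
    using h by (intro bounded_linear_compose[OF h] bounded_linear_Pair bounded_linear_ident
        bounded_linear_zero)+
  then have "real_polynomial_function (\<lambda>x. h (f x, 0))" "real_polynomial_function (\<lambda>x. h (0, g x))"
    using assms unfolding polynomial_function_def o_def by blast+
  ultimately show "real_polynomial_function (h \<circ> (\<lambda>x. (f x, g x)))"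
    by (simp add: o_def real_polynomial_function.intros(3))
qed

lemma real_polynomial_function_component:
  fixes f :: "'a::real_normed_vector \<Rightarrow> real^'m"
  shows "polynomial_function f \<Longrightarrow> real_polynomial_function (\<lambda>x. f x $ i)"
  unfolding cart_eq_inner_axis real_polynomial_function_eq by (rule polynomial_function_inner)

lemma polynomial_function_vec_lambda:
  fixes f :: "'a::real_normed_vector \<Rightarrow> 'm::finite \<Rightarrow> real"
  assumes "\<And>i. real_polynomial_function (\<lambda>x. f x i)"
  shows "polynomial_function (\<lambda>x. \<chi> i. f x i)"
  unfolding polynomial_function_iff_Basis_inner
  using assms by (auto simp: Basis_vec_def inner_axis)

lemma polynomial_function_vec_iff:
  fixes f :: "'a::real_normed_vector \<Rightarrow> real^'n"
  shows "polynomial_function f \<longleftrightarrow> (\<forall>i. real_polynomial_function (\<lambda>x. f x $ i))"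
  using real_polynomial_function_component[of f] polynomial_function_vec_lambda[of "\<lambda>x i. f x $ i"]
  by auto

lemma real_polynomial_function_det:
  fixes M :: "'b::real_normed_vector \<Rightarrow> real^'a^'a"
  assumes "\<And>i j. real_polynomial_function (\<lambda>x. M x $ i $ j)"
  shows "real_polynomial_function (\<lambda>x. det (M x))"
proof -
  have "real_polynomial_function (\<lambda>x. \<Prod>i\<in>UNIV. M x $ i $ p i)" for p :: "'a \<Rightarrow> 'a"
    using assms by (intro real_polynomial_function_prod) simp_all
  then have "real_polynomial_function (\<lambda>x. of_int (sign p) * (\<Prod>i\<in>UNIV. M x $ i $ p i))"
    for p :: "'a \<Rightarrow> 'a"
    by (intro real_polynomial_function.intros(4)[OF real_polynomial_function.intros(2)])
  then show ?thesis
    unfolding det_def by (intro real_polynomial_function_sum) simp_all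
qed

text \<open>
The derivative depends continuously on the point because each of its entries is a polynomial; so
for polynomial maps the inverse function theorem only asks for invertibility at one point.
\<close>

lemma polynomial_inverse_function:
  fixes f :: "'a::euclidean_space \<Rightarrow> 'a"
  assumes f: "polynomial_function f" and inj: "inj (frechet_derivative f (at x0))"
    and U: "open U" "x0 \<in> U"
  obtains W V g where "open W" "W \<subseteq> U" "x0 \<in> W" "open V" "f x0 \<in> V" "homeomorphism W V f g"
    "\<And>y. y \<in> V \<Longrightarrow> g differentiable (at y)"
proof -
  let ?f' = "\<lambda>x. Blinfun (frechet_derivative f (at x))"
  have bl: "bounded_linear (frechet_derivative f (at x))" for x
    using polynomial_function_has_derivative[OF f] has_derivative_bounded_linear by blast
  then have app: "blinfun_apply (?f' x) = frechet_derivative f (at x)" for x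
    by (rule bounded_linear_Blinfun_apply)
  have "continuous_on U ?f'"
    by (intro continuous_on_blinfun_componentwise)
      (simp add: app continuous_on_polymonial_function polynomial_function_frechet_derivative_fixed f)
  moreover
  obtain h where h: "linear h" "h \<circ> frechet_derivative f (at x0) = id"
    using bl inj linear_injective_left_inverse bounded_linear.linear by blast
  then have "Blinfun h o\<^sub>L ?f' x0 = id_blinfun"
    by (intro blinfun_eqI)
      (simp add: app bounded_linear_Blinfun_apply linear_conv_bounded_linear[symmetric]
        fun_eq_iff[symmetric] pointfree_idE)
  ultimately obtain W V g g' where "open W" "W \<subseteq> U" "x0 \<in> W" "open V" "f x0 \<in> V"
    "homeomorphism W V f g" "\<And>y. y \<in> V \<Longrightarrow> (g has_derivative (g' y)) (at y)"
    using inverse_function_theorem[OF U(1) _ _ U(2), of f ?f' "Blinfun h"]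
      polynomial_function_has_derivative[OF f]
    by (metis app)
  then show thesis
    using that by (meson differentiableI)
qed

section \<open>The partial Jacobian determinant\<close>

text \<open>
The Jacobian determinant with respect to the first \<open>CARD('m)\<close> variables only; the real variable
plays the part of the homotopy parameter.
\<close>

definition partial_jacobian :: "((real^'m) \<times> real \<Rightarrow> real^'m) \<Rightarrow> (real^'m) \<times> real \<Rightarrow> real" where
  "partial_jacobian E w = det (matrix (\<lambda>d. frechet_derivative E (at w) (d, 0)))"

lemma linear_partial_derivative:
  fixes E :: "(real^'m) \<times> real \<Rightarrow> real^'m"
  assumes "polynomial_function E"
  shows "linear (\<lambda>d. frechet_derivative E (at w) (d, 0))"
proof -
  have "linear (frechet_derivative E (at w))"
    using assms polynomial_function_has_derivative has_derivative_linear by blast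
  moreover have "linear (\<lambda>d. (d, 0::real))"
    by (rule linearI) auto
  ultimately show ?thesis
    using linear_compose[of "\<lambda>d. (d, 0)" "frechet_derivative E (at w)"] by (simp add: o_def)
qed

lemma partial_jacobian_nonzero_iff:
  fixes E :: "(real^'m) \<times> real \<Rightarrow> real^'m"
  assumes "polynomial_function E"
  shows "partial_jacobian E w \<noteq> 0 \<longleftrightarrow> inj (\<lambda>d. frechet_derivative E (at w) (d, 0))"
  unfolding partial_jacobian_def by (rule det_nz_iff_inj[OF linear_partial_derivative[OF assms]])

lemma real_polynomial_function_partial_jacobian:
  fixes E :: "(real^'m) \<times> real \<Rightarrow> real^'m"
  assumes "polynomial_function E"
  shows "real_polynomial_function (partial_jacobian E)"
proof -
  have "real_polynomial_function (\<lambda>w. frechet_derivative E (at w) (axis j 1, 0) $ i)" for i j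
    by (intro real_polynomial_function_component polynomial_function_frechet_derivative_fixed assms)
  then have "real_polynomial_function
      (\<lambda>w. det (matrix (\<lambda>d. frechet_derivative E (at w) (d, 0))))"
    by (intro real_polynomial_function_det) (simp add: matrix_def)
  then show ?thesis
    unfolding partial_jacobian_def[abs_def] .
qed

lemma frechet_derivative_diff_scaled_parameter:
  fixes E :: "'a::euclidean_space \<times> real \<Rightarrow> 'b::euclidean_space"
  assumes "polynomial_function E"
  shows "frechet_derivative (\<lambda>w. E w - snd w *\<^sub>R c) (at w)
    = (\<lambda>d. frechet_derivative E (at w) d - snd d *\<^sub>R c)"
proof -
  have "((\<lambda>w. E w - snd w *\<^sub>R c) has_derivative
      (\<lambda>d. frechet_derivative E (at w) d - snd d *\<^sub>R c)) (at w)"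
    by (intro has_derivative_diff has_derivative_scaleR_left has_derivative_snd
        has_derivative_ident polynomial_function_has_derivative assms)
  then show ?thesis
    by (rule frechet_derivative_at[symmetric])
qed

section \<open>Critical values of a polynomial family when the dimension drops by one\<close>

text \<open>
A polynomial in one variable all of whose derivatives vanish at one point \<open>a\<close> is zero: by induction
on the degree its derivative is zero, hence it is constant, and the constant is its value at \<open>a\<close>.
\<close>

lemma real_polynomial_nonzero_iterated_derivative:
  fixes h :: "nat \<Rightarrow> real \<Rightarrow> real"
  assumes poly: "real_polynomial_function (h 0)"
    and der: "\<And>k x. (h k has_real_derivative h (Suc k) x) (at x)"
    and nz: "h 0 b \<noteq> 0"
  shows "\<exists>k. h k a \<noteq> 0"
proof (rule ccontr)
  assume "\<nexists>k. h k a \<noteq> 0"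
  then have van: "h k a = 0" for k by blast
  obtain c n where "h 0 = (\<lambda>x. \<Sum>i\<le>n. c i * x ^ i)"
    using real_polynomial_function_imp_sum[OF poly] by blast
  then have "h 0 = poly (\<Sum>i\<le>n. monom (c i) i)"
    by (simp add: poly_sum poly_monom fun_eq_iff)
  then obtain p where p: "h 0 = poly p" by blast
  have hk: "h k = poly ((pderiv ^^ k) p)" for k
  proof (induction k)
    case (Suc k)
    have "h (Suc k) x = poly (pderiv ((pderiv ^^ k) p)) x" for x
      using der[of k x] unfolding Suc by (rule DERIV_unique) (rule poly_DERIV)
    then show ?case by auto
  qed (simp add: p)
  have "p = 0" if "\<And>k. poly ((pderiv ^^ k) p) a = 0" for p :: "real poly"
    using that
  proof (induction "degree p" arbitrary: p rule: less_induct)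
    case less
    have "pderiv p = 0"
    proof (cases "degree p = 0")
      case True
      then show ?thesis by (simp add: pderiv_eq_0_iff)
    next
      case False
      have "poly ((pderiv ^^ k) (pderiv p)) a = 0" for k
        using less.prems[of "Suc k"] by (simp add: funpow_swap1)
      then show ?thesis
        using False by (intro less.hyps) (simp_all add: degree_pderiv)
    qed
    then obtain c where "p = [:c:]"
      by (auto simp: pderiv_eq_0_iff elim: degree_eq_zeroE)
    then show ?case
      using less.prems[of 0] by simp
  qed
  then have "p = 0"
    using van hk by metis
  then show False
    using nz p by simp
qed

text \<open>
The implicit function theorem for one equation, solved for the last variable.  It follows from
the inverse function theorem for \<open>(v, \<mu>) \<mapsto> (v, h(v, \<mu>))\<close>, whose inverse on the slice where the last
coordinate is \<open>0\<close> parametrizes the zero set by \<open>v\<close>.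
\<close>

lemma zero_set_locally_graph:
  fixes h :: "'a::euclidean_space \<times> real \<Rightarrow> real"
  assumes h: "real_polynomial_function h"
    and nz: "frechet_derivative h (at w0) (0, 1) \<noteq> 0" and "h w0 = 0"
  obtains W V \<phi> where "open W" "w0 \<in> W" "\<And>v. v \<in> V \<Longrightarrow> \<phi> differentiable (at v)"
    "\<And>w. w \<in> W \<Longrightarrow> h w = 0 \<Longrightarrow> fst w \<in> V \<and> snd w = \<phi> (fst w)"
proof -
  define f where "f = (\<lambda>w. (fst w, h w))"
  have poly: "polynomial_function f"
    unfolding polynomial_function_iff_Basis_inner f_def using h
    by (auto simp: Basis_prod_def intro!: real_polynomial_function.intros(1)
        bounded_linear_inner_left_comp bounded_linear_fst)
  have "(f has_derivative (\<lambda>d. (fst d, frechet_derivative h (at w0) d))) (at w0)"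
    unfolding f_def
    by (intro has_derivative_Pair has_derivative_fst has_derivative_ident
        real_polynomial_function_has_derivative h)
  then have f': "frechet_derivative f (at w0) = (\<lambda>d. (fst d, frechet_derivative h (at w0) d))"
    by (rule frechet_derivative_at[symmetric])
  have lin: "linear (frechet_derivative h (at w0))"
    using real_polynomial_function_has_derivative[OF h] has_derivative_linear by blast
  have "linear (frechet_derivative f (at w0))"
    using polynomial_function_has_derivative[OF poly] has_derivative_linear by blast
  moreover have "d = 0" if "frechet_derivative f (at w0) d = 0" for d
  proof -
    have "d = snd d *\<^sub>R (0, 1)" "frechet_derivative h (at w0) d = 0"
      using that by (auto simp: f' zero_prod_def prod_eq_iff)
    then have "snd d = 0"
      using nz linear_cmul[OF lin, of "snd d" "(0, 1)"] by auto
    then show ?thesis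
      using \<open>d = snd d *\<^sub>R (0, 1)\<close> by (simp add: zero_prod_def)
  qed
  ultimately have "inj (frechet_derivative f (at w0))"
    by (simp add: linear_injective_0)
  from polynomial_inverse_function[OF poly this open_UNIV UNIV_I]
  obtain W V g where W: "open W" "w0 \<in> W" and "homeomorphism W V f g"
    and g: "\<And>y. y \<in> V \<Longrightarrow> g differentiable (at y)" by metis
  then have gf: "f w \<in> V" "g (f w) = w" if "w \<in> W" for w
    using that by (auto simp: homeomorphism_def)
  show thesis
  proof (rule that[of W "{v. (v, 0) \<in> V}" "\<lambda>v. snd (g (v, 0))"])
    fix v assume "v \<in> {v. (v, 0) \<in> V}"
    then obtain g' where "(g has_derivative g') (at (v, 0))"
      using g unfolding differentiable_def by blast
    moreover have "((\<lambda>v. (v, 0::real)) has_derivative (\<lambda>d. (d, 0))) (at v)"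
      by (auto intro!: derivative_eq_intros)
    ultimately have "((\<lambda>v. g (v, 0)) has_derivative (\<lambda>d. g' (d, 0))) (at v)"
      by (rule has_derivative_compose[rotated])
    then show "(\<lambda>v. snd (g (v, 0))) differentiable (at v)"
      using has_derivative_snd differentiableI by blast
  next
    fix w assume "w \<in> W" "h w = 0"
    then show "fst w \<in> {v. (v, 0) \<in> V} \<and> snd w = snd (g (fst w, 0))"
      using gf[of w] by (simp add: f_def)
  qed (use W in auto)
qed

text \<open>
By Lindelof's theorem countably many of the given neighbourhoods cover \<open>S\<close>.
\<close>

lemma negligible_image_if_locally:
  fixes f :: "'a::euclidean_space \<Rightarrow> 'b::euclidean_space"
  assumes "\<And>x. x \<in> S \<Longrightarrow> \<exists>U. open U \<and> x \<in> U \<and> negligible (f ` (S \<inter> U))"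
  shows "negligible (f ` S)"
proof -
  define F where "F = {U. open U \<and> negligible (f ` (S \<inter> U))}"
  have "\<And>U. U \<in> F \<Longrightarrow> open U"
    by (simp add: F_def)
  from Lindelof[OF this] obtain F' where F': "F' \<subseteq> F" "countable F'" "\<Union>F' = \<Union>F"
    by metis
  have "S \<subseteq> \<Union>F'"
    using assms unfolding F'(3) F_def by blast
  then have "f ` S \<subseteq> (\<Union>U\<in>F'. f ` (S \<inter> U))"
    by blast
  moreover have "negligible (\<Union>U\<in>F'. f ` (S \<inter> U))"
    using F' by (intro negligible_countable_Union) (auto simp: F_def)
  ultimately show ?thesis
    by (rule negligible_subset[rotated])
qed

text \<open>
On a piece of the zero set that is a graph \<open>\<mu> = \<phi>(v)\<close>, the values of \<open>\<Psi>\<close> are those of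
\<open>v \<mapsto> \<Psi>(v, \<phi>(v))\<close>.  The derivative of this map factors through that of \<open>\<Psi>\<close>; so it is singular
wherever the latter is not onto, and the Sard theorem for equal dimensions applies.
\<close>

lemma negligible_critical_values_on_zero_set:
  fixes h :: "(real^'m::{finite,wellorder}) \<times> real \<Rightarrow> real"
    and \<Psi> :: "(real^'m::_) \<times> real \<Rightarrow> real^'m::_"
  assumes h: "real_polynomial_function h"
    and S: "\<And>w. w \<in> S \<Longrightarrow> h w = 0 \<and> frechet_derivative h (at w) (0, 1) \<noteq> 0"
    and crit: "\<And>w. w \<in> S \<Longrightarrow> (\<Psi> has_derivative \<Psi>' w) (at w) \<and> \<not> surj (\<Psi>' w)"
  shows "negligible (\<Psi> ` S)"
proof (rule negligible_image_if_locally)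
  fix w0 assume "w0 \<in> S"
  with S have w0: "h w0 = 0" "frechet_derivative h (at w0) (0, 1) \<noteq> 0" by auto
  obtain W V \<phi> where W: "open W" "w0 \<in> W"
    and \<phi>: "\<And>v. v \<in> V \<Longrightarrow> \<phi> differentiable (at v)"
    and graph: "\<And>w. w \<in> W \<Longrightarrow> h w = 0 \<Longrightarrow> fst w \<in> V \<and> snd w = \<phi> (fst w)"
    using zero_set_locally_graph[OF h w0(2,1)] by blast
  define \<phi>' where "\<phi>' = (\<lambda>v. frechet_derivative \<phi> (at v))"
  define T where "T = fst ` (S \<inter> W)"
  have T: "v \<in> V" "(v, \<phi> v) \<in> S \<inter> W" if "v \<in> T" for v
  proof -
    obtain w where w: "w \<in> S" "w \<in> W" "v = fst w"
      using \<open>v \<in> T\<close> unfolding T_def by blast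
    then have "fst w \<in> V \<and> snd w = \<phi> (fst w)"
      using S graph by blast
    then show "v \<in> V" "(v, \<phi> v) \<in> S \<inter> W"
      using w by (metis prod.collapse IntI)+
  qed
  define \<psi>' where "\<psi>' = (\<lambda>v d. \<Psi>' (v, \<phi> v) (d, \<phi>' v d))"
  have der: "((\<lambda>v. \<Psi> (v, \<phi> v)) has_derivative \<psi>' v) (at v)" if "v \<in> T" for v
  proof -
    have "(\<phi> has_derivative \<phi>' v) (at v)"
      using \<phi> T that frechet_derivative_works unfolding \<phi>'_def by blast
    then have "((\<lambda>v. (v, \<phi> v)) has_derivative (\<lambda>d. (d, \<phi>' v d))) (at v)"
      by (intro has_derivative_Pair has_derivative_ident)
    moreover have "(\<Psi> has_derivative \<Psi>' (v, \<phi> v)) (at (v, \<phi> v))"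
      using crit T that by blast
    ultimately show ?thesis
      unfolding \<psi>'_def by (rule has_derivative_compose)
  qed
  have "negligible ((\<lambda>v. \<Psi> (v, \<phi> v)) ` T)"
  proof (rule baby_Sard[where f' = \<psi>'])
    fix v assume v: "v \<in> T"
    then show "((\<lambda>v. \<Psi> (v, \<phi> v)) has_derivative \<psi>' v) (at v within T)"
      using der has_derivative_at_withinI by blast
    have lin: "linear (\<psi>' v)"
      using der[OF v] has_derivative_linear by blast
    have "\<not> surj (\<psi>' v)"
      using crit T[OF v] unfolding \<psi>'_def surj_def by blast
    then have "\<not> surj ((*v) (matrix (\<psi>' v)))"
      using lin by (simp add: matrix_works)
    then show "rank (matrix (\<psi>' v)) < CARD('m)"
      using full_rank_surjective[of "matrix (\<psi>' v)"] rank_bound[of "matrix (\<psi>' v)"] by simp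
  qed simp
  moreover have "\<Psi> ` (S \<inter> W) \<subseteq> (\<lambda>v. \<Psi> (v, \<phi> v)) ` T"
  proof
    fix c assume "c \<in> \<Psi> ` (S \<inter> W)"
    then obtain w where w: "w \<in> S" "w \<in> W" "c = \<Psi> w" by blast
    then have "snd w = \<phi> (fst w)"
      using S graph by blast
    then have "c = \<Psi> (fst w, \<phi> (fst w))"
      using w by (metis prod.collapse)
    then show "c \<in> (\<lambda>v. \<Psi> (v, \<phi> v)) ` T"
      using w unfolding T_def by blast
  qed
  ultimately show "\<exists>U. open U \<and> w0 \<in> U \<and> negligible (\<Psi> ` (S \<inter> U))"
    using W negligible_subset by blast
qed

text \<open>
For each \<open>k\<close>, one set \<open>S k\<close> collects the critical points of \<open>\<Psi> = E / \<mu>\<close> at which the \<open>k\<close>-th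
derivative of the partial Jacobian with respect to \<open>\<mu>\<close> vanishes and the next one does not.  Such a
\<open>k\<close> exists because the partial Jacobian is polynomial in \<open>\<mu>\<close> and not identically zero on the line
through the point in the direction of \<open>\<mu>\<close>; this is where its value at \<open>\<mu> = 1\<close> enters.
\<close>

lemma negligible_critical_parameters:
  fixes E :: "(real^'m::{finite,wellorder}) \<times> real \<Rightarrow> real^'m::_"
  assumes E: "polynomial_function E"
  shows "negligible {c. \<exists>v \<mu>. \<mu> \<noteq> 0 \<and> E (v, \<mu>) = \<mu> *\<^sub>R c \<and> partial_jacobian E (v, 1) \<noteq> 0 \<and>
           \<not> surj (frechet_derivative (\<lambda>w. E w - snd w *\<^sub>R c) (at (v, \<mu>)))}" (is "negligible ?B")
proof -
  define h where "h k = ((\<lambda>g w. frechet_derivative g (at w) (0, 1)) ^^ k) (partial_jacobian E)" for k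
  have h_Suc: "h (Suc k) = (\<lambda>w. frechet_derivative (h k) (at w) (0, 1))" for k
    by (simp add: h_def)
  have h: "real_polynomial_function (h k)" for k
  proof (induction k)
    case 0
    then show ?case by (simp add: h_def real_polynomial_function_partial_jacobian E)
  qed (simp add: h_Suc real_polynomial_function_frechet_derivative)
  define \<Psi> where "\<Psi> = (\<lambda>w. (1 / snd w) *\<^sub>R E w)"
  define \<Psi>' where "\<Psi>' = (\<lambda>w d. (1 / snd w) *\<^sub>R (frechet_derivative E (at w) d - snd d *\<^sub>R \<Psi> w))"
  have \<Psi>': "(\<Psi> has_derivative \<Psi>' w) (at w)" if "snd w \<noteq> 0" for w
  proof -
    have "(\<Psi> has_derivative (\<lambda>d. inverse (snd w) *\<^sub>R frechet_derivative E (at w) d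
        + (- (inverse (snd w) * snd d * inverse (snd w))) *\<^sub>R E w)) (at w)"
      unfolding \<Psi>_def divide_inverse mult_1
      using that by (intro has_derivative_scaleR Deriv.has_derivative_inverse has_derivative_snd
          has_derivative_ident polynomial_function_has_derivative E)
    moreover have "(\<lambda>d. inverse (snd w) *\<^sub>R frechet_derivative E (at w) d
        + (- (inverse (snd w) * snd d * inverse (snd w))) *\<^sub>R E w) = \<Psi>' w"
      by (simp add: \<Psi>'_def \<Psi>_def fun_eq_iff algebra_simps divide_inverse)
    ultimately show ?thesis by simp
  qed
  define S where "S k = {w. h k w = 0 \<and> h (Suc k) w \<noteq> 0 \<and> snd w \<noteq> 0 \<and> \<not> surj (\<Psi>' w)}" for k
  have neg: "negligible (\<Psi> ` S k)" for k
    by (rule negligible_critical_values_on_zero_set[OF h[of k], where \<Psi>' = \<Psi>'])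
      (auto simp: S_def h_Suc \<Psi>')
  have "?B \<subseteq> (\<Union>k. \<Psi> ` S k)"
  proof
    fix c assume "c \<in> ?B"
    then obtain v \<mu> where "\<mu> \<noteq> 0" and c: "E (v, \<mu>) = \<mu> *\<^sub>R c" and J: "partial_jacobian E (v, 1) \<noteq> 0"
      and nsurj: "\<not> surj (frechet_derivative (\<lambda>w. E w - snd w *\<^sub>R c) (at (v, \<mu>)))"
      by (elim CollectE exE conjE)
    have \<Psi>c: "\<Psi> (v, \<mu>) = c"
      using \<open>\<mu> \<noteq> 0\<close> c by (simp add: \<Psi>_def)
    from nsurj have "\<exists>y. \<forall>d. y \<noteq> frechet_derivative E (at (v, \<mu>)) d - snd d *\<^sub>R c"
      by (simp add: surj_def frechet_derivative_diff_scaled_parameter[OF E])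
    then obtain y where y: "\<And>d. y \<noteq> frechet_derivative E (at (v, \<mu>)) d - snd d *\<^sub>R c"
      by blast
    have "(1 / \<mu>) *\<^sub>R y \<noteq> \<Psi>' (v, \<mu>) d" for d
      using y[of d] \<open>\<mu> \<noteq> 0\<close> by (simp add: \<Psi>'_def \<Psi>c)
    then have crit: "\<not> surj (\<Psi>' (v, \<mu>))"
      unfolding surj_def by blast
    have "y \<noteq> frechet_derivative E (at (v, \<mu>)) (d, 0)" for d
      using y[of "(d, 0)"] by simp
    then have "\<not> surj (\<lambda>d. frechet_derivative E (at (v, \<mu>)) (d, 0))"
      unfolding surj_def by blast
    then have J0: "h 0 (v, \<mu>) = 0"
      using partial_jacobian_nonzero_iff[OF E, of "(v, \<mu>)"]
        linear_injective_imp_surjective[OF linear_partial_derivative[OF E, of "(v, \<mu>)"]]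
      by (auto simp: h_def)
    have "\<exists>k. h k (v, \<mu>) \<noteq> 0"
    proof (rule real_polynomial_nonzero_iterated_derivative[of "\<lambda>k t. h k (v, t)"])
      have "polynomial_function (\<lambda>t. (v, 0) + t *\<^sub>R (0, 1::real))"
        by (intro polynomial_function_add polynomial_function_mult) auto
      then have "polynomial_function (\<lambda>t::real. (v, t))"
        by simp
      from real_polynomial_function_compose[OF this h[of 0]]
      show "real_polynomial_function (\<lambda>t. h 0 (v, t))"
        by (simp add: o_def)
      show "((\<lambda>t. h k (v, t)) has_real_derivative h (Suc k) (v, t)) (at t)" for k t
      proof -
        have "((\<lambda>t. (v, t)) has_derivative (\<lambda>s. (0, s))) (at t)"
          by (auto intro!: derivative_eq_intros)
        then have "((\<lambda>t. h k (v, t)) has_derivative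
            (\<lambda>s. frechet_derivative (h k) (at (v, t)) (0, s))) (at t)"
          by (rule has_derivative_compose) (rule real_polynomial_function_has_derivative[OF h])
        moreover have "frechet_derivative (h k) (at (v, t)) (0, s) = h (Suc k) (v, t) * s" for s
          using linear_cmul[OF has_derivative_linear[OF
                real_polynomial_function_has_derivative[OF h[of k], of "(v, t)"]], of s "(0, 1)"]
          by (simp add: h_Suc)
        ultimately show ?thesis
          by (simp add: has_field_derivative_def)
      qed
      show "h 0 (v, 1) \<noteq> 0"
        using J by (simp add: h_def)
    qed
    with J0 obtain j where "h j (v, \<mu>) = 0" "h (Suc j) (v, \<mu>) \<noteq> 0"
      using nat_induct[of "\<lambda>k. h k (v, \<mu>) = 0"] by metis
    with crit \<open>\<mu> \<noteq> 0\<close> have "(v, \<mu>) \<in> S j"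
      by (simp add: S_def)
    with \<Psi>c show "c \<in> (\<Union>k. \<Psi> ` S k)" by blast
  qed
  moreover have "negligible (\<Union>k. \<Psi> ` S k)"
    using neg by (intro negligible_countable_Union) auto
  ultimately show ?thesis
    by (rule negligible_subset[rotated])
qed

section \<open>Smooth solution curves of polynomial equations\<close>

text \<open>
The quotient rule preserves the form \<open>P(u) / J(u)\<^sup>e\<close>: differentiating it along \<open>u' = M(u) / J(u)\<close>
yields \<open>(J \<cdot> DP M - e (DJ M) P)(u) / J(u)\<^sup>e\<^sup>+\<^sup>2\<close>.  Starting from \<open>u\<close> itself, with \<open>e = 0\<close> and \<open>P\<close>
the identity, the \<open>k\<close>-th derivative has exponent \<open>e = 2k\<close>.
\<close>

lemma derivatives_along_rational_flow:
  fixes u :: "real \<Rightarrow> 'b::euclidean_space" and M :: "'b \<Rightarrow> 'b" and J :: "'b \<Rightarrow> real"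
  assumes M: "polynomial_function M" and J: "real_polynomial_function J"
    and u: "\<And>t. t \<in> T \<Longrightarrow> (u has_vector_derivative inverse (J (u t)) *\<^sub>R M (u t)) (at t within T)"
    and nz: "\<And>t. t \<in> T \<Longrightarrow> J (u t) \<noteq> 0"
  obtains D where "D 0 = u"
    "\<And>k t. t \<in> T \<Longrightarrow> (D k has_vector_derivative D (Suc k) t) (at t within T)"
    "\<And>t. t \<in> T \<Longrightarrow> D 1 t = inverse (J (u t)) *\<^sub>R M (u t)"
proof -
  \<comment> \<open>numerator of the \<open>k\<close>-th derivative, with denominator \<open>J (u t) ^ (2 * k)\<close>\<close>
  define P where "P = rec_nat (\<lambda>x. x) (\<lambda>k P x. J x *\<^sub>R frechet_derivative P (at x) (M x)
      - (real (2 * k) * frechet_derivative J (at x) (M x)) *\<^sub>R P x)"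
  have P0: "P 0 = (\<lambda>x. x)"
    and P_Suc: "P (Suc k) = (\<lambda>x. J x *\<^sub>R frechet_derivative (P k) (at x) (M x)
      - (real (2 * k) * frechet_derivative J (at x) (M x)) *\<^sub>R P k x)" for k
    by (simp_all add: P_def)
  have J': "polynomial_function (\<lambda>x. frechet_derivative J (at x) (M x))"
    using polynomial_function_frechet_derivative M J by (simp add: real_polynomial_function_eq)
  have P: "polynomial_function (P k)" for k
  proof (induction k)
    case (Suc k)
    have "polynomial_function (\<lambda>x. real (2 * k) * frechet_derivative J (at x) (M x))"
      using J' polynomial_function_cmul by fastforce
    then show ?case
      unfolding P_Suc using Suc M J real_polynomial_function_eq[of J]
      by (intro polynomial_function_diff polynomial_function_mult
          polynomial_function_frechet_derivative) simp_all
  qed (simp add: P0)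
  define D where "D k t = inverse (J (u t)) ^ (2 * k) *\<^sub>R P k (u t)" for k t
  have "(D k has_vector_derivative D (Suc k) t) (at t within T)" if "t \<in> T" for k t
  proof -
    define a where "a = inverse (J (u t))"
    define dJ where "dJ = frechet_derivative J (at (u t)) (M (u t))"
    define dP where "dP = frechet_derivative (P k) (at (u t)) (M (u t))"
    have a: "a * J (u t) = 1"
      using nz[OF that] by (simp add: a_def)
    have chain: "((\<lambda>t. f (u t)) has_vector_derivative a *\<^sub>R frechet_derivative f (at (u t)) (M (u t)))
        (at t within T)" if f: "polynomial_function f" for f :: "'b \<Rightarrow> 'c::euclidean_space"
    proof -
      have f': "(f has_derivative frechet_derivative f (at (u t))) (at (u t))"
        using f by (rule polynomial_function_has_derivative)
      have "(f \<circ> u has_vector_derivative frechet_derivative f (at (u t)) (a *\<^sub>R M (u t))) (at t within T)"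
        using u[OF \<open>t \<in> T\<close>] has_derivative_at_withinI[OF f'] unfolding a_def
        by (rule vector_derivative_diff_chain_within)
      then show ?thesis
        using linear_cmul[OF has_derivative_linear[OF f']] by (simp add: o_def)
    qed
    have "((\<lambda>t. J (u t)) has_real_derivative a * dJ) (at t within T)"
      using chain[of J] J unfolding has_real_derivative_iff_has_vector_derivative dJ_def
      by (simp add: real_polynomial_function_eq)
    then have "((\<lambda>t. inverse (J (u t))) has_real_derivative - (a * (a * dJ) * a)) (at t within T)"
      using nz[OF that] unfolding a_def by (rule DERIV_inverse')
    then have "((\<lambda>t. inverse (J (u t)) ^ (2 * k)) has_real_derivative
        real (2 * k) * (- (a * (a * dJ) * a) * a ^ (2 * k - Suc 0))) (at t within T)"
      unfolding a_def by (rule DERIV_power)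
    moreover have "real (2 * k) * (- (a * (a * dJ) * a) * a ^ (2 * k - Suc 0))
        = - (real (2 * k) * dJ * a ^ (2 * Suc k))"
      by (cases k) (simp_all add: algebra_simps)
    ultimately have "((\<lambda>t. inverse (J (u t)) ^ (2 * k)) has_real_derivative
        - (real (2 * k) * dJ * a ^ (2 * Suc k))) (at t within T)"
      by (simp only:)
    from has_vector_derivative_scaleR[OF this chain[OF P[of k]]]
    have "(D k has_vector_derivative a ^ (2 * k) *\<^sub>R a *\<^sub>R dP
        + (- (real (2 * k) * dJ * a ^ (2 * Suc k))) *\<^sub>R P k (u t)) (at t within T)"
      unfolding D_def[abs_def] a_def dP_def .
    moreover have "D (Suc k) t = a ^ (2 * k) *\<^sub>R a *\<^sub>R dP
        + (- (real (2 * k) * dJ * a ^ (2 * Suc k))) *\<^sub>R P k (u t)"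
    proof -
      have "a ^ (2 * Suc k) * J (u t) = a ^ (2 * k) * a * (a * J (u t))"
        by (simp add: algebra_simps)
      then have "a ^ (2 * Suc k) * J (u t) = a ^ (2 * k) * a"
        using a by simp
      then show ?thesis
        unfolding D_def P_Suc a_def[symmetric] dJ_def[symmetric] dP_def[symmetric] scaleR_diff_right
        by (simp add: mult.commute mult.left_commute del: power_Suc mult_Suc_right)
    qed
    ultimately show ?thesis by simp
  qed
  moreover have "D 0 = u"
    by (simp add: D_def[abs_def] P0)
  moreover have "D 1 t = inverse (J (u t)) *\<^sub>R M (u t)" if "t \<in> T" for t
    using nz[OF that] by (simp add: D_def P_Suc P0 power2_eq_square)
  ultimately show thesis
    using that by blast
qed

text \<open>
The map \<open>w \<mapsto> (F w, snd w)\<close> has invertible derivative at \<open>(p, 1)\<close>, and its local inverse, applied to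
\<open>(0, 1 - \<delta> t)\<close>, is the curve.  Differentiating \<open>F (u t) = 0\<close> gives a linear system for the first
component of \<open>u'\<close>, and Cramer's rule turns it into a polynomial vector divided by the partial
Jacobian.
\<close>

lemma smooth_solution_curve:
  fixes F :: "(real^'m) \<times> real \<Rightarrow> real^'m"
  assumes F: "polynomial_function F" and zero: "F (p, 1) = 0"
    and reg: "partial_jacobian F (p, 1) \<noteq> 0" and U: "open U" "(p, 1) \<in> U"
  shows "\<exists>\<Gamma>. \<Gamma> \<subseteq> {w \<in> U. F w = 0 \<and> snd w \<le> 1} \<and> smooth_curve_from (p, 1) \<Gamma>"
proof -
  define J where "J = partial_jacobian F"
  have J: "real_polynomial_function J"
    unfolding J_def using F by (rule real_polynomial_function_partial_jacobian)
  define Q where "Q = (\<lambda>w. (F w, snd w))"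
  have Q: "polynomial_function Q"
    unfolding Q_def using F polynomial_function_bounded_linear[OF bounded_linear_snd]
    by (rule polynomial_function_Pair)
  have F': "(F has_derivative frechet_derivative F (at w)) (at w)" for w
    using F by (rule polynomial_function_has_derivative)
  have "(Q has_derivative (\<lambda>d. (frechet_derivative F (at w) d, snd d))) (at w)" for w
    unfolding Q_def by (intro has_derivative_Pair has_derivative_snd has_derivative_ident F')
  then have Q': "frechet_derivative Q (at w) = (\<lambda>d. (frechet_derivative F (at w) d, snd d))" for w
    by (rule frechet_derivative_at[symmetric])
  have "inj (frechet_derivative Q (at (p, 1)))"
  proof (rule injI)
    fix d e assume "frechet_derivative Q (at (p, 1)) d = frechet_derivative Q (at (p, 1)) e"
    then have F_eq: "frechet_derivative F (at (p, 1)) d = frechet_derivative F (at (p, 1)) e"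
      and snd_eq: "snd d = snd e"
      by (simp_all add: Q')
    have "frechet_derivative F (at (p, 1)) (d - e) = 0"
      using F_eq linear_diff[OF has_derivative_linear[OF F'[of "(p, 1)"]], of d e] by simp
    moreover have "d - e = (fst d - fst e, 0)"
      using snd_eq by (simp add: prod_eq_iff)
    ultimately have "frechet_derivative F (at (p, 1)) (fst d - fst e, 0)
        = frechet_derivative F (at (p, 1)) (0, 0)"
      using linear_0[OF has_derivative_linear[OF F'[of "(p, 1)"]]] by (simp add: zero_prod_def)
    then have "fst d - fst e = 0"
      using reg partial_jacobian_nonzero_iff[OF F] by (auto dest: injD)
    with snd_eq show "d = e"
      by (simp add: prod_eq_iff)
  qed
  \<comment> \<open>shrinking \<open>U\<close> keeps the denominator \<open>J\<close> nonzero along the curve\<close>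
  moreover have "open (U \<inter> {w. J w \<noteq> 0})"
    using U(1) J continuous_on_polymonial_function[of J UNIV]
    by (intro open_Int open_Collect_neq continuous_on_const)
      (simp_all add: real_polynomial_function_eq)
  moreover have "(p, 1) \<in> U \<inter> {w. J w \<noteq> 0}"
    using U(2) reg by (simp add: J_def)
  ultimately obtain W V g where W: "W \<subseteq> U \<inter> {w. J w \<noteq> 0}" "(p, 1) \<in> W"
    and V: "open V" "Q (p, 1) \<in> V" and hom: "homeomorphism W V Q g"
    and g: "\<And>y. y \<in> V \<Longrightarrow> g differentiable (at y)"
    using polynomial_inverse_function[OF Q] by metis
  have gV: "g y \<in> W" "Q (g y) = y" if "y \<in> V" for y
    using hom that by (auto simp: homeomorphism_def)
  have "(0, 1) \<in> V"
    using V(2) zero by (simp add: Q_def)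
  then obtain \<delta> where \<delta>: "\<delta> > 0" "ball (0, 1) \<delta> \<subseteq> V"
    using V(1) open_contains_ball by metis
  have inV: "(0, 1 - \<delta> * t) \<in> V" if "t \<in> {-1<..<1}" for t
  proof -
    have "\<delta> * \<bar>t\<bar> < \<delta> * 1"
      using that \<delta>(1) by (intro mult_strict_left_mono) auto
    then have "dist (0::real^'m, 1::real) (0, 1 - \<delta> * t) < \<delta>"
      using \<delta>(1) by (simp add: dist_Pair_Pair dist_real_def abs_mult)
    then show ?thesis
      using \<delta>(2) by auto
  qed
  \<comment> \<open>negative \<open>t\<close> are included so that two-sided derivatives exist at \<open>t = 0\<close>\<close>
  define u where "u t = g (0, 1 - \<delta> * t)" for t
  have uW: "u t \<in> W" and Fu: "F (u t) = 0" and snd_u: "snd (u t) = 1 - \<delta> * t"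
    if "t \<in> {-1<..<1}" for t
    using gV[OF inV[OF that]] by (simp_all add: u_def Q_def)
  define A where "A w = matrix (\<lambda>d. frechet_derivative F (at w) (d, 0))" for w
  define b where "b w = \<delta> *\<^sub>R frechet_derivative F (at w) (0, 1)" for w
  define M where "M w = ((\<chi> k. det (\<chi> i j. if j = k then b w $ i else A w $ i $ j)), - \<delta> * J w)" for w
  have "real_polynomial_function (\<lambda>w. (if j = k then b w $ i else A w $ i $ j))" for i j k
  proof -
    have "polynomial_function b"
      unfolding b_def[abs_def]
      by (intro polynomial_function_cmul polynomial_function_frechet_derivative_fixed F)
    then show ?thesis
      by (cases "j = k")
        (simp_all add: A_def matrix_def real_polynomial_function_component
          polynomial_function_frechet_derivative_fixed F)
  qed
  then have "real_polynomial_function (\<lambda>w. det (\<chi> i j. if j = k then b w $ i else A w $ i $ j))" for k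
    by (intro real_polynomial_function_det) simp
  then have M: "polynomial_function M"
    unfolding M_def[abs_def] using J polynomial_function_cmul[of J "- \<delta>"]
    by (intro polynomial_function_Pair polynomial_function_vec_lambda)
      (simp_all add: real_polynomial_function_eq)
  have flow: "(u has_vector_derivative inverse (J (u t)) *\<^sub>R M (u t)) (at t)"
    if t: "t \<in> {-1<..<1}" for t
  proof -
    obtain g' where "(g has_derivative g') (at (0, 1 - \<delta> * t))"
      using g[OF inV[OF t]] unfolding differentiable_def by blast
    moreover have "((\<lambda>t. (0::real^'m, 1 - \<delta> * t)) has_vector_derivative (0, - \<delta>)) (at t)"
      by (auto intro!: derivative_eq_intros)
    ultimately have u': "(u has_vector_derivative g' (0, - \<delta>)) (at t)"
      unfolding u_def[abs_def]
      using vector_derivative_diff_chain_within[of "\<lambda>t. (0, 1 - \<delta> * t)" _ t UNIV g g']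
      by (auto simp: o_def intro: has_derivative_at_withinI)
    define y where "y = g' (0, - \<delta>)"
    have "(Q \<circ> u has_vector_derivative frechet_derivative Q (at (u t)) y) (at t)"
      using u' vector_derivative_diff_chain_within[of u _ t UNIV Q]
        has_derivative_at_withinI[OF polynomial_function_has_derivative[OF Q]]
      unfolding y_def by blast
    then have "((\<lambda>t. (0, 1 - \<delta> * t)) has_vector_derivative frechet_derivative Q (at (u t)) y) (at t)"
      using t gV inV by (rule_tac has_vector_derivative_transform_within_open[of "Q \<circ> u" _ _ "{-1<..<1}"])
        (auto simp: u_def)
    then have "frechet_derivative Q (at (u t)) y = (0, - \<delta>)"
      by (rule vector_derivative_unique_at) (auto intro!: derivative_eq_intros)
    then have Fy: "frechet_derivative F (at (u t)) y = 0" and snd_y: "snd y = - \<delta>"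
      by (simp_all add: Q')
    interpret linear "frechet_derivative F (at (u t))"
      using F' has_derivative_linear by blast
    have "y = (fst y, 0) + (- \<delta>) *\<^sub>R (0, 1)"
      using snd_y by (simp add: prod_eq_iff)
    then have "frechet_derivative F (at (u t)) (fst y, 0) = b (u t)"
      using Fy add[of "(fst y, 0)" "(- \<delta>) *\<^sub>R (0, 1)"] scaleR[of "- \<delta>" "(0, 1)"]
      by (simp add: b_def)
    then have "A (u t) *v fst y = b (u t)"
      using linear_partial_derivative[OF F] by (simp add: A_def matrix_works)
    moreover have Ju: "J (u t) \<noteq> 0" "det (A (u t)) = J (u t)"
      using uW[OF t] W(1) by (auto simp: J_def partial_jacobian_def A_def)
    ultimately have "fst y = (\<chi> k. det (\<chi> i j. if j = k then b (u t) $ i else A (u t) $ i $ j) / J (u t))"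
      using cramer[of "A (u t)" "fst y" "b (u t)"] by simp
    then have "y = inverse (J (u t)) *\<^sub>R M (u t)"
      using snd_y Ju(1) by (simp add: M_def prod_eq_iff vec_eq_iff divide_inverse mult.commute)
    then show ?thesis
      using u' y_def by simp
  qed
  have "(u has_vector_derivative inverse (J (u t)) *\<^sub>R M (u t)) (at t within {0..<1})"
    and "J (u t) \<noteq> 0" if "t \<in> {0..<1}" for t
    using that flow[of t] uW[of t] W(1) by (auto intro: has_vector_derivative_at_within)
  from derivatives_along_rational_flow[OF M J this]
  obtain D where D0: "D 0 = u"
    and D: "\<And>k t. t \<in> {0..<1} \<Longrightarrow> (D k has_vector_derivative D (Suc k) t) (at t within {0..<1})"
    and D1: "\<And>t. t \<in> {0..<1} \<Longrightarrow> D 1 t = inverse (J (u t)) *\<^sub>R M (u t)"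
    by metis
  have "D 1 t \<noteq> 0" if "t \<in> {0..<1}" for t
  proof
    assume "D 1 t = 0"
    then have "inverse (J (u t)) * (- \<delta> * J (u t)) = 0"
      using D1[OF that] by (simp add: M_def prod_eq_iff)
    then show False
      using that uW[of t] W(1) \<delta>(1) by auto
  qed
  moreover have "homeomorphism {0..<1} (u ` {0..<1}) (D 0) (\<lambda>w. (1 - snd w) / \<delta>)"
  proof -
    have "continuous_on {0..<1} u"
      using D[of _ 0] D0 by (metis continuous_on_eq_continuous_within has_vector_derivative_continuous)
    moreover have "continuous_on (u ` {0..<1}) (\<lambda>w. (1 - snd w) / \<delta>)"
      using \<delta>(1) by (intro continuous_intros) auto
    moreover have "(1 - snd (u t)) / \<delta> = t" if "t \<in> {0..<1}" for t
      using that \<delta>(1) snd_u[of t] by simp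
    ultimately show ?thesis
      unfolding D0 homeomorphism_def by (auto simp: image_image)
  qed
  moreover have "D 0 0 = (p, 1)"
  proof -
    have "g (Q (p, 1)) = (p, 1)"
      using hom W(2) by (simp add: homeomorphism_def)
    then show ?thesis
      using zero by (simp add: D0 u_def Q_def)
  qed
  ultimately have "smooth_curve_from (p, 1) (u ` {0..<1})"
    unfolding smooth_curve_from_def using D by blast
  moreover have "u ` {0..<1} \<subseteq> {w \<in> U. F w = 0 \<and> snd w \<le> 1}"
  proof
    fix w assume "w \<in> u ` {0..<1}"
    then obtain t where "t \<in> {0..<1}" "w = u t" by blast
    then show "w \<in> {w \<in> U. F w = 0 \<and> snd w \<le> 1}"
      using uW[of t] Fu[of t] snd_u[of t] W(1) \<delta>(1) by auto
  qed
  ultimately show ?thesis by blast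
qed

lemma smooth_curve_from_linear_image:
  assumes L: "bounded_linear L" and L': "bounded_linear L'" and inv: "\<And>x. L' (L x) = x"
    and "smooth_curve_from p \<Gamma>"
  shows "smooth_curve_from (L p) (L ` \<Gamma>)"
proof -
  obtain D g where
    D: "\<And>k t. t \<in> {0..<1} \<Longrightarrow> (D k has_vector_derivative D (Suc k) t) (at t within {0..<1})"
    and D1: "\<And>t. t \<in> {0..<1} \<Longrightarrow> D 1 t \<noteq> 0"
    and hom: "homeomorphism {0..<1} \<Gamma> (D 0) g" and start: "D 0 0 = p"
    using assms(4) unfolding smooth_curve_from_def by blast
  define D' where "D' k t = L (D k t)" for k and t :: real
  have "(D' k has_vector_derivative D' (Suc k) t) (at t within {0..<1})" if "t \<in> {0..<1}" for k t
    unfolding D'_def[abs_def] by (rule bounded_linear.has_vector_derivative[OF L D[OF that]])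
  moreover have "D' 1 t \<noteq> 0" if "t \<in> {0..<1}" for t
  proof
    assume "D' 1 t = 0"
    then have "L' (L (D 1 t)) = L' 0" by (simp add: D'_def)
    then show False
      using D1[OF that] inv linear_0[OF bounded_linear.linear[OF L']] by simp
  qed
  moreover have "homeomorphism \<Gamma> (L ` \<Gamma>) L L'"
    unfolding homeomorphism_def using inv
    by (auto simp: image_image intro: linear_continuous_on[OF L] linear_continuous_on[OF L'])
  then have "homeomorphism {0..<1} (L ` \<Gamma>) (D' 0) (g \<circ> L')"
    using homeomorphism_compose[OF hom] by (simp add: D'_def[abs_def] o_def)
  moreover have "D' 0 0 = L p"
    by (simp add: D'_def start)
  ultimately show ?thesis
    unfolding smooth_curve_from_def by blast
qed

section \<open>The homotopy and its dependence on the starting point\<close>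

text \<open>
The homotopy depends on the starting point only through these four vectors, and affinely so.
\<close>

definition start_data :: "('n::finite) quad \<Rightarrow> 'n quad" where
  "start_data = (\<lambda>(x0, w0, z10, z20). (x0, diag z10 *v x0, diag z20 *v w0, w0))"

lemma diag_mult_component: "(diag z *v x) $ i = z $ i * x $ i"
  by (simp add: diag_def matrix_vector_mult_def if_distrib[of "\<lambda>a. a * b" for b] cong: if_cong)

lemma homotopy_eq_diff_start_data:
  "homotopy m A q v v0 \<mu> = homotopy m A q v 0 \<mu> - \<mu> *\<^sub>R start_data v0"
  by (cases v; cases v0) (simp add: start_data_def zero_prod_def diag_mult_component algebra_simps)

lemma differentiable_vec_lambda:
  fixes f :: "'a::euclidean_space \<Rightarrow> 'n::finite \<Rightarrow> real"
  assumes "\<And>i. (\<lambda>x. f x i) differentiable (at a within S)"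
  shows "(\<lambda>x. \<chi> i. f x i) differentiable (at a within S)"
  using assms by (subst differentiable_componentwise_within) (auto simp: Basis_vec_def inner_axis)

lemma differentiable_Pair:
  assumes "f differentiable (at a within S)" "g differentiable (at a within S)"
  shows "(\<lambda>x. (f x, g x)) differentiable (at a within S)"
proof -
  obtain f' g' where "(f has_derivative f') (at a within S)" "(g has_derivative g') (at a within S)"
    using assms unfolding differentiable_def by blast
  then have "((\<lambda>x. (f x, g x)) has_derivative (\<lambda>h. (f' h, g' h))) (at a within S)"
    by (rule has_derivative_Pair)
  then show ?thesis
    by (rule differentiableI)
qed

text \<open>
On \<open>F1\<close> the map \<open>start_data\<close> is inverted by dividing its second and third block by the components
of \<open>x0\<close> and \<open>w0\<close>.  This inverse is differentiable where those components are nonzero and so maps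
null sets to null sets.
\<close>

lemma negligible_start_data_preimage:
  fixes N :: "('n::finite) quad set"
  assumes "negligible N"
  shows "negligible {v0 \<in> F1. start_data v0 \<in> N}"
proof -
  define X where "X = (fst :: 'n quad \<Rightarrow> real^'n)"
  define C where "C p = fst (snd p)" for p :: "'n quad"
  define D where "D p = fst (snd (snd p))" for p :: "'n quad"
  define W where "W p = snd (snd (snd p))" for p :: "'n quad"
  define R where "R p = (X p, W p, (\<chi> i. C p $ i / X p $ i), (\<chi> i. D p $ i / W p $ i))" for p
  define G where "G = {p. \<forall>i. X p $ i \<noteq> 0 \<and> W p $ i \<noteq> 0}"
  have "bounded_linear X" "bounded_linear C" "bounded_linear D" "bounded_linear W"
    unfolding X_def C_def[abs_def] D_def[abs_def] W_def[abs_def]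
    by (intro bounded_linear_fst bounded_linear_snd bounded_linear_fst_comp bounded_linear_snd_comp)+
  then have lin: "X differentiable (at p within S)" "C differentiable (at p within S)"
      "D differentiable (at p within S)" "W differentiable (at p within S)" for p S
    by (auto intro: bounded_linear_imp_differentiable)
  have vec_nth: "(\<lambda>p. h p $ i) differentiable (at p within S)" if "h differentiable (at p within S)"
    for h :: "'n quad \<Rightarrow> real^'n" and p S i
    using that unfolding differentiable_def
    by (blast intro: bounded_linear.has_derivative[OF bounded_linear_vec_nth])
  have "R differentiable (at p within S)" if "p \<in> G" for p S
    unfolding R_def[abs_def] using that
    by (intro differentiable_Pair lin differentiable_vec_lambda differentiable_divide vec_nth)
      (auto simp: G_def)
  then have "R differentiable_on N \<inter> G"
    by (simp add: differentiable_on_def)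
  then have "negligible (R ` (N \<inter> G))"
    using assms by (intro negligible_differentiable_image_negligible) (auto intro: negligible_Int)
  moreover have inv: "v0 \<in> R ` (N \<inter> G)" if "v0 \<in> F1" "start_data v0 \<in> N" for v0
  proof (rule image_eqI)
    obtain x w z1 z2 where v0: "v0 = (x, w, z1, z2)" by (cases v0)
    then have pos: "x $ i \<noteq> 0" "w $ i \<noteq> 0" for i
      using that(1) by (auto simp: F1_def less_le)
    show "start_data v0 \<in> N \<inter> G"
      using that pos by (auto simp: v0 G_def start_data_def X_def W_def)
    show "v0 = R (start_data v0)"
      using pos by (simp add: v0 R_def start_data_def X_def W_def C_def D_def diag_mult_component vec_eq_iff)
  qed
  then have "{v0 \<in> F1. start_data v0 \<in> N} \<subseteq> R ` (N \<inter> G)"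
    by (intro subsetI) (elim CollectE conjE, rule inv)
  ultimately show ?thesis
    by (rule negligible_subset)
qed

lemma polynomial_function_diag_mult:
  assumes "polynomial_function f" "polynomial_function g"
  shows "polynomial_function (\<lambda>w. diag (f w) *v g w)"
  using assms unfolding polynomial_function_vec_iff diag_mult_component
  by (intro allI real_polynomial_function.intros(4)) simp_all

lemma real_polynomial_function_monomial_at:
  assumes "polynomial_function f"
  shows "real_polynomial_function (\<lambda>w. monomial_at (f w) is)"
  using assms unfolding polynomial_function_vec_iff monomial_at_def
  by (induction "is") (simp_all add: real_polynomial_function.intros(2,4))

lemma polynomial_function_tensor_vector:
  assumes "polynomial_function f"
  shows "polynomial_function (\<lambda>w. tensor_vector m A (f w))"
  unfolding polynomial_function_vec_iff tensor_vector_def vec_lambda_beta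
  by (intro allI real_polynomial_function_sum
      real_polynomial_function.intros(4)[OF real_polynomial_function.intros(2)]
      real_polynomial_function_monomial_at assms finite_list_length)

lemma polynomial_function_transpose_tensor_matrix_mult:
  assumes "polynomial_function f" "polynomial_function g"
  shows "polynomial_function (\<lambda>w. transpose (tensor_matrix m A (f w)) *v g w)"
proof -
  have "real_polynomial_function (\<lambda>w. tensor_matrix m A (f w) $ i $ j)" for i j
    unfolding tensor_matrix_def vec_lambda_beta
    by (intro real_polynomial_function_sum
        real_polynomial_function.intros(4)[OF real_polynomial_function.intros(2)]
        real_polynomial_function_monomial_at assms finite_list_length)
  then show ?thesis
    using assms(2)
    unfolding polynomial_function_vec_iff matrix_vector_mult_def vec_lambda_beta transpose_def
    by (intro allI real_polynomial_function_sum real_polynomial_function.intros(4)) simp_all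
qed

lemma polynomial_function_homotopy:
  fixes f :: "'a::real_normed_vector \<Rightarrow> ('n::finite) quad"
  assumes "polynomial_function f" "real_polynomial_function g"
  shows "polynomial_function (\<lambda>w. homotopy m A q (f w) 0 (g w))"
proof -
  have lin: "polynomial_function (\<lambda>w. h (f w))" if "bounded_linear h" for h :: "'n quad \<Rightarrow> real^'n"
    using polynomial_function_compose[OF assms(1) polynomial_function_bounded_linear[OF that]]
    by (simp add: o_def)
  define x where "x w = fst (f w)" for w
  define y where "y w = fst (snd (f w))" for w
  define z1 where "z1 w = fst (snd (snd (f w)))" for w
  define z2 where "z2 w = snd (snd (snd (f w)))" for w
  have polys: "polynomial_function x" "polynomial_function y" "polynomial_function z1"
      "polynomial_function z2"
    unfolding x_def[abs_def] y_def[abs_def] z1_def[abs_def] z2_def[abs_def]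
    by (intro lin bounded_linear_intros bounded_linear_fst bounded_linear_snd
        bounded_linear_fst_comp bounded_linear_snd_comp)+
  have g: "polynomial_function g" "polynomial_function (\<lambda>w. 1 - g w)"
    using assms(2) by (auto simp: real_polynomial_function_eq)
  have "homotopy m A q (f w) 0 (g w) =
    ((1 - g w) *\<^sub>R (y w - z1 w + (real m - 1) *\<^sub>R
         (transpose (tensor_matrix m (partial_symmetrization A) (x w)) *v (x w - z2 w))) + g w *\<^sub>R x w,
     diag (z1 w) *v x w,
     diag (z2 w) *v y w + (1 - g w) *\<^sub>R (diag (x w) *v y w),
     y w - (1 - g w) *\<^sub>R (tensor_vector m A (x w) + q))" for w
    by (cases "f w") (simp add: zero_prod_def x_def y_def z1_def z2_def)
  then show ?thesis
    by (simp only:) (intro polynomial_function_Pair polynomial_function_add polynomial_function_diff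
        polynomial_function_mult polynomial_function_cmul polynomial_function_const
        polynomial_function_diag_mult polynomial_function_tensor_vector
        polynomial_function_transpose_tensor_matrix_mult polys g)
qed

text \<open>
The second block says \<open>z1 x = \<mu> z1\<^sub>0 x0\<close> and the third \<open>w (z2 + (1 - \<mu>) x) = \<mu> z2\<^sub>0 w0\<close> componentwise,
and both right-hand sides are positive.
\<close>

lemma homotopy_zero_nonzero_components:
  fixes v v0 :: "('n::finite) quad"
  assumes zero: "homotopy m A q v v0 \<mu> = 0" and "v0 \<in> F1" and "\<mu> > 0"
  shows "fst v $ i \<noteq> 0" "fst (snd v) $ i \<noteq> 0"
proof -
  obtain x w z1 z2 where v: "v = (x, w, z1, z2)" by (cases v)
  obtain x0 w0 z10 z20 where v0: "v0 = (x0, w0, z10, z20)" by (cases v0)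
  have "z10 $ i * x0 $ i \<noteq> 0" "z20 $ i * w0 $ i \<noteq> 0"
    using \<open>v0 \<in> F1\<close> by (auto simp: v0 F1_def less_le)
  moreover have "z1 $ i * x $ i - \<mu> * (z10 $ i * x0 $ i) = 0"
    and "z2 $ i * w $ i - \<mu> * (z20 $ i * w0 $ i) + (1 - \<mu>) * (x $ i * w $ i) = 0"
    using arg_cong[OF zero, of "\<lambda>p. fst (snd p) $ i"]
      arg_cong[OF zero, of "\<lambda>p. fst (snd (snd p)) $ i"]
    by (simp_all add: v v0 diag_mult_component)
  ultimately show "fst v $ i \<noteq> 0" "fst (snd v) $ i \<noteq> 0"
    using \<open>\<mu> > 0\<close> by (auto simp: v)
qed

text \<open>
At \<open>\<mu> = 1\<close> with starting point \<open>0\<close> the homotopy is \<open>(x, Z1 x, Z2 w, w)\<close>; the tensor no longer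
occurs.  The first and last block of a vanishing directional derivative give \<open>dx = 0\<close> and \<open>dw = 0\<close>,
and then the other two give \<open>x dz1 = 0\<close> and \<open>w dz2 = 0\<close>.
\<close>

lemma homotopy_at_one_injective_derivative:
  fixes v d :: "('n::finite) quad"
  assumes nz: "\<And>i. fst v $ i \<noteq> 0 \<and> fst (snd v) $ i \<noteq> 0"
    and der: "((\<lambda>s. homotopy m A q (v + s *\<^sub>R d) 0 1) has_vector_derivative 0) (at 0)"
  shows "d = 0"
proof -
  obtain x w z1 z2 where v: "v = (x, w, z1, z2)" by (cases v)
  obtain dx dw dz1 dz2 where d: "d = (dx, dw, dz1, dz2)" by (cases d)
  have H: "homotopy m A q (v + s *\<^sub>R d) 0 1 = (x + s *\<^sub>R dx, diag (z1 + s *\<^sub>R dz1) *v (x + s *\<^sub>R dx),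
      diag (z2 + s *\<^sub>R dz2) *v (w + s *\<^sub>R dw), w + s *\<^sub>R dw)" for s
    by (simp add: v d zero_prod_def)
  have der0: "((\<lambda>s. h (homotopy m A q (v + s *\<^sub>R d) 0 1)) has_real_derivative 0) (at 0)"
    if h: "bounded_linear h" for h
    using bounded_linear.has_vector_derivative[OF h der] linear_0[OF bounded_linear.linear[OF h]]
    by (simp add: has_real_derivative_iff_has_vector_derivative)
  have comp: "bounded_linear (\<lambda>p. h p $ i)" if "bounded_linear h" for h :: "'n quad \<Rightarrow> real^'n" and i
    by (rule bounded_linear_compose[OF bounded_linear_vec_nth that])
  note lins = bounded_linear_fst bounded_linear_snd bounded_linear_fst_comp bounded_linear_snd_comp
  have line: "b * r = c" if "((\<lambda>s. (a + s * b) * r) has_real_derivative c) (at 0)" for a b c r :: real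
  proof (rule DERIV_unique)
    show "((\<lambda>s. (a + s * b) * r) has_real_derivative b * r) (at 0)"
      by (auto intro!: derivative_eq_intros)
  qed (rule that)
  have "((\<lambda>s. x $ i + s * dx $ i) has_real_derivative 0) (at 0)" for i
    using der0[OF comp[of fst i]] by (simp add: H bounded_linear_fst)
  then have dx: "dx $ i = 0" for i
    using line[of "x $ i" "dx $ i" 1 0] by simp
  have "((\<lambda>s. w $ i + s * dw $ i) has_real_derivative 0) (at 0)" for i
    using der0[OF comp[of "\<lambda>p. snd (snd (snd p))" i]] by (simp add: H lins)
  then have dw: "dw $ i = 0" for i
    using line[of "w $ i" "dw $ i" 1 0] by simp
  have "((\<lambda>s. (z1 $ i + s * dz1 $ i) * x $ i) has_real_derivative 0) (at 0)" for i
    using der0[OF comp[of "\<lambda>p. fst (snd p)" i]] dx by (simp add: H lins diag_mult_component)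
  then have "dz1 $ i * x $ i = 0" for i
    by (rule line)
  moreover
  have "((\<lambda>s. (z2 $ i + s * dz2 $ i) * w $ i) has_real_derivative 0) (at 0)" for i
    using der0[OF comp[of "\<lambda>p. fst (snd (snd p))" i]] dw by (simp add: H lins diag_mult_component)
  then have "dz2 $ i * w $ i = 0" for i
    by (rule line)
  ultimately show ?thesis
    using nz dx dw by (simp add: v d zero_prod_def vec_eq_iff)
qed

lemma open_F1: "open (F1 :: ('n::finite) quad set)"
proof -
  have "F1 = (\<Inter>i. {v::'n quad. 0 < fst v $ i} \<inter> {v. 0 < fst (snd v) $ i} \<inter>
      {v. 0 < fst (snd (snd v)) $ i} \<inter> {v. 0 < snd (snd (snd v)) $ i})"
    by (auto simp: F1_def)
  also have "open \<dots>"
    by (intro open_INT ballI finite open_Int open_Collect_less continuous_intros)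
  finally show ?thesis .
qed

section \<open>Almost all starting points\<close>

theorem theorem3p1:
  fixes m :: nat and A :: "('n::finite) tensor" and q :: "real^'n"
  assumes "m \<ge> 2"
  shows "AE v0 in lebesgue. v0 \<in> F1 \<longrightarrow>
           regular_value (\<lambda>(v, \<mu>). homotopy m A q v v0 \<mu>) (UNIV \<times> {0<..1}) 0 \<and>
           (\<exists>\<Gamma>. \<Gamma> \<subseteq> homotopy_zeros m A q v0 \<and> smooth_curve_from (v0, 1) \<Gamma>)"
proof -
  \<comment> \<open>\<open>'n bit0 bit0\<close> is a well-ordered index type with \<open>4 * CARD('n)\<close> elements; it makes determinants available\<close>
  have "DIM('n quad) = DIM(real^('n bit0 bit0))"
    by simp
  then obtain S :: "'n quad \<Rightarrow> real^('n bit0 bit0)" and T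
    where lin: "linear S" "linear T" and ST: "\<And>y. S (T y) = y" and TS: "\<And>v. T (S v) = v"
    by (rule isomorphisms_UNIV_UNIV) metis
  then have blin: "bounded_linear S" "bounded_linear T"
    by (simp_all add: linear_conv_bounded_linear)
  define E where "E w = S (homotopy m A q (T (fst w)) 0 (snd w))" for w
  have "polynomial_function (\<lambda>w. homotopy m A q (T (fst w)) 0 (snd w))"
    by (intro polynomial_function_homotopy polynomial_function_bounded_linear
        real_polynomial_function.intros(1) bounded_linear_compose[OF blin(2)]
        bounded_linear_fst bounded_linear_snd)
  from polynomial_function_compose[OF this polynomial_function_bounded_linear[OF blin(1)]]
  have E: "polynomial_function E"
    by (simp add: E_def[abs_def] o_def)
  have E_eq: "E (S v, \<mu>) - \<mu> *\<^sub>R S (start_data v0) = S (homotopy m A q v v0 \<mu>)" for v v0 \<mu>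
    unfolding homotopy_eq_diff_start_data[of m A q v v0 \<mu>]
    using lin by (simp add: E_def TS linear_diff linear_cmul)
  have J1: "partial_jacobian E (S v, 1) \<noteq> 0" if nz: "\<And>i. fst v $ i \<noteq> 0 \<and> fst (snd v) $ i \<noteq> 0" for v
  proof -
    have "d = 0" if d: "frechet_derivative E (at (S v, 1)) (d, 0) = 0" for d
    proof -
      have "((\<lambda>s. (S v, 1::real) + s *\<^sub>R (d, 0)) has_vector_derivative (d, 0)) (at 0)"
        by (auto intro!: derivative_eq_intros)
      then have "(E \<circ> (\<lambda>s. (S v, 1) + s *\<^sub>R (d, 0)) has_vector_derivative
          frechet_derivative E (at (S v, 1)) (d, 0)) (at 0)"
        by (rule vector_derivative_diff_chain_within)
          (simp add: has_derivative_at_withinI[OF polynomial_function_has_derivative[OF E]])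
      from bounded_linear.has_vector_derivative[OF blin(2) this]
      have "((\<lambda>s. homotopy m A q (v + s *\<^sub>R T d) 0 1) has_vector_derivative 0) (at 0)"
        using lin by (simp add: d E_def o_def TS linear_0 linear_add linear_cmul)
      from homotopy_at_one_injective_derivative[OF nz this]
      show "d = 0"
        using ST[of d] lin by (simp add: linear_0)
    qed
    then show ?thesis
      unfolding partial_jacobian_nonzero_iff[OF E] linear_injective_0[OF linear_partial_derivative[OF E]]
      by blast
  qed
  define B where "B = {c. \<exists>y \<mu>. \<mu> \<noteq> 0 \<and> E (y, \<mu>) = \<mu> *\<^sub>R c \<and> partial_jacobian E (y, 1) \<noteq> 0 \<and>
    \<not> surj (frechet_derivative (\<lambda>w. E w - snd w *\<^sub>R c) (at (y, \<mu>)))}"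
  have "negligible B"
    unfolding B_def by (rule negligible_critical_parameters[OF E])
  then have "negligible (T ` B)"
    using lin(2) by (intro negligible_differentiable_image_negligible)
      (simp_all add: linear_imp_differentiable_on)
  then have null: "negligible {v0 \<in> F1. start_data v0 \<in> T ` B}"
    by (rule negligible_start_data_preimage)
  have "regular_value (\<lambda>(v, \<mu>). homotopy m A q v v0 \<mu>) (UNIV \<times> {0<..1}) 0 \<and>
      (\<exists>\<Gamma>. \<Gamma> \<subseteq> homotopy_zeros m A q v0 \<and> smooth_curve_from (v0, 1) \<Gamma>)"
    if v0: "v0 \<in> F1" and good: "start_data v0 \<notin> T ` B" for v0
  proof
    define c where "c = S (start_data v0)"
    define F where "F w = E w - snd w *\<^sub>R c" for w
    have F: "polynomial_function F"
      unfolding F_def[abs_def] using E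
      by (intro polynomial_function_diff polynomial_function_mult
          polynomial_function_bounded_linear[OF bounded_linear_snd] polynomial_function_const)
    have F_eq: "F (S v, \<mu>) = S (homotopy m A q v v0 \<mu>)" for v \<mu>
      using E_eq by (simp add: F_def c_def)
    show "regular_value (\<lambda>(v, \<mu>). homotopy m A q v v0 \<mu>) (UNIV \<times> {0<..1}) 0"
      unfolding regular_value_def
    proof (intro ballI impI)
      fix u :: "'n quad \<times> real"
      assume "u \<in> UNIV \<times> {0<..1}" and zero: "(case u of (v, \<mu>) \<Rightarrow> homotopy m A q v v0 \<mu>) = 0"
      then obtain v \<mu> where u: "u = (v, \<mu>)" and "\<mu> > 0" and Hz: "homotopy m A q v v0 \<mu> = 0"
        by auto
      have "E (S v, \<mu>) = \<mu> *\<^sub>R c"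
        using F_eq[of v \<mu>] Hz lin(1) by (simp add: F_def linear_0)
      moreover have "partial_jacobian E (S v, 1) \<noteq> 0"
        using homotopy_zero_nonzero_components[OF Hz v0 \<open>\<mu> > 0\<close>] by (intro J1) blast
      moreover have "\<mu> \<noteq> 0"
        using \<open>\<mu> > 0\<close> by simp
      moreover have "c \<notin> B"
        using good TS unfolding c_def by (metis imageI)
      ultimately have surj: "surj (frechet_derivative F (at (S v, \<mu>)))"
        unfolding B_def F_def[abs_def, symmetric] mem_Collect_eq by metis
      \<comment> \<open>the derivative of the homotopy, read back in the original coordinates\<close>
      define H' where "H' d = T (frechet_derivative F (at (S v, \<mu>)) (S (fst d), snd d))" for d
      have "((\<lambda>w. (S (fst w), snd w)) has_derivative (\<lambda>d. (S (fst d), snd d))) (at u)"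
        by (intro has_derivative_Pair has_derivative_snd has_derivative_ident
            bounded_linear.has_derivative[OF blin(1)] has_derivative_fst)
      moreover have "(F has_derivative frechet_derivative F (at (S v, \<mu>))) (at (S (fst u), snd u))"
        unfolding u using polynomial_function_has_derivative[OF F] by simp
      ultimately have "((\<lambda>w. F (S (fst w), snd w)) has_derivative
          (\<lambda>d. frechet_derivative F (at (S v, \<mu>)) (S (fst d), snd d))) (at u)"
        by (rule has_derivative_compose)
      from bounded_linear.has_derivative[OF blin(2) this]
      have "((\<lambda>(v, \<mu>). homotopy m A q v v0 \<mu>) has_derivative H') (at u)"
        by (simp add: F_eq TS H'_def[abs_def] case_prod_beta')
      moreover have "surj H'"
      proof (rule surjI)
        fix y
        define d where "d = inv (frechet_derivative F (at (S v, \<mu>))) (S y)"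
        show "H' (T (fst d), snd d) = y"
          using surj_f_inv_f[OF surj, of "S y"] by (simp add: H'_def ST TS d_def)
      qed
      ultimately show "\<exists>f'. ((\<lambda>(v, \<mu>). homotopy m A q v v0 \<mu>) has_derivative f')
          (at u within UNIV \<times> {0<..1}) \<and> surj f'"
        using has_derivative_at_withinI by blast
    qed
    define U where "U = {w. T (fst w) \<in> F1 \<and> 0 < (snd w :: real)}"
    have open_U: "open U"
    proof -
      have "continuous_on UNIV (\<lambda>w :: _ \<times> real. T (fst w))"
        by (intro linear_continuous_on bounded_linear_compose[OF blin(2)] bounded_linear_fst)
      then have "open ((\<lambda>w :: _ \<times> real. T (fst w)) -` F1)"
        by (rule open_vimage[OF open_F1])
      moreover have "open {w :: _ \<times> real. 0 < snd w}"
        by (intro open_Collect_less continuous_intros)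
      ultimately show ?thesis
        by (auto simp: U_def vimage_def Collect_conj_eq intro: open_Int)
    qed
    have start_U: "(S v0, 1) \<in> U"
      using v0 by (simp add: U_def TS)
    have start_zero: "F (S v0, 1) = 0"
    proof -
      have "homotopy m A q v0 v0 1 = 0"
        by (cases v0) (simp add: zero_prod_def)
      then show ?thesis
        using lin(1) by (simp add: F_eq linear_0)
    qed
    have start_regular: "partial_jacobian F (S v0, 1) \<noteq> 0"
    proof -
      have "fst v0 $ i \<noteq> 0 \<and> fst (snd v0) $ i \<noteq> 0" for i
        using v0 by (auto simp: F1_def less_le)
      moreover have "partial_jacobian F (S v0, 1) = partial_jacobian E (S v0, 1)"
        unfolding partial_jacobian_def F_def[abs_def] frechet_derivative_diff_scaled_parameter[OF E]
        by simp
      ultimately show ?thesis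
        using J1 by simp
    qed
    from smooth_solution_curve[OF F start_zero start_regular open_U start_U]
    obtain \<Gamma> where \<Gamma>: "\<Gamma> \<subseteq> {w \<in> U. F w = 0 \<and> snd w \<le> 1}"
      and curve: "smooth_curve_from (S v0, 1) \<Gamma>"
      by (elim exE conjE)
    define L where "L w = (T (fst w), snd w)" for w :: "(real^('n bit0 bit0)) \<times> real"
    have "smooth_curve_from (L (S v0, 1)) (L ` \<Gamma>)"
    proof (rule smooth_curve_from_linear_image[OF _ _ _ curve])
      show "bounded_linear L"
        unfolding L_def[abs_def]
        by (intro bounded_linear_Pair bounded_linear_compose[OF blin(2)] bounded_linear_fst bounded_linear_snd)
      show "bounded_linear (\<lambda>w. (S (fst w), snd w))"
        by (intro bounded_linear_Pair bounded_linear_compose[OF blin(1)] bounded_linear_fst bounded_linear_snd)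
    qed (simp add: L_def ST)
    moreover have "L ` \<Gamma> \<subseteq> homotopy_zeros m A q v0"
    proof
      fix p assume "p \<in> L ` \<Gamma>"
      then obtain y \<mu> where w: "(y, \<mu>) \<in> \<Gamma>" "p = (T y, \<mu>)"
        by (auto simp: L_def)
      then have "F (S (T y), \<mu>) = 0" "T y \<in> F1" "0 < \<mu>" "\<mu> \<le> 1"
        using \<Gamma> by (auto simp: U_def ST)
      moreover from this(1) have "T (S (homotopy m A q (T y) v0 \<mu>)) = 0"
        using lin(2) by (simp add: F_eq linear_0 del: TS)
      ultimately show "p \<in> homotopy_zeros m A q v0"
        by (simp add: homotopy_zeros_def w TS)
    qed
    ultimately show "\<exists>\<Gamma>. \<Gamma> \<subseteq> homotopy_zeros m A q v0 \<and> smooth_curve_from (v0, 1) \<Gamma>"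
      by (auto simp: L_def TS)
  qed
  then show ?thesis
    by (intro AE_I'[OF null[unfolded negligible_iff_null_sets]] subsetI) blast
qed

end
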